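(* Let $\mathfrak v_8$ be a $C(8)$-module and $\mathfrak v_r$ a $C(r)$-module, and let $\mathfrak v_8\otimes\mathfrak v_r$ carry the $C(8+r)$-module structure $J_{(z,w)}=J_z\otimes\mathrm{Id}+K_8\otimes J_w$. If $\mathcal L_r\in{\rm Lag}(\mathfrak v_r)$ and $\mathcal L_8\in{\rm Lag}(\mathfrak v_8)$, then $$\mathcal L_8\otimes\mathcal L_r+\mathcal L_8^\perp\otimes\mathcal L_r^\perp\ \in\ {\rm Lag}(\mathfrak v_8\otimes\mathfrak v_r).$$
   Context: $C(k)$ is the real Clifford algebra of $\mathbb R^k$ with relations $z^2=-\langle z,z\rangle 1$; a $C(k)$-module $\mathfrak w$ has an inner product making each $J_z$ skew-symmetric, and defines the Lie algebra of Heisenberg type $\mathfrak w\oplus\mathbb R^k$ with $\mathbb R^k$ central and $\langle z,[u,v]\rangle=\langle J_zu,v\rangle$. $K_8=J_{z_1}\cdots J_{z_8}$ for an orthonormal basis of $\mathbb R^8$. ${\rm Lag}(\mathfrak w)$ is the set of subspaces $\mathcal L\subset\mathfrak w$ with $[\mathcal L,\mathcal L]=0$ and $\dim\mathcal L=\frac12\dim\mathfrak w$; $\perp$ denotes orthogonal complement; $\mathfrak v_8\otimes\mathfrak v_r$ has the tensor product inner product. *)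

theory Defs
  imports "HOL-Analysis.Analysis"
begin

text \<open>A C(k)-module structure on the Euclidean space real^'n (standard inner product)
  is given by the images Js = [J_{e_1},...,J_{e_k}] of an orthonormal basis of R^k:
  each J_i is skew-symmetric and J_i J_j + J_j J_i = -2 delta_ij Id.
  Then J_z = sum z_i J_i satisfies J_z^2 = -|z|^2 Id and is skew-symmetric.\<close>

definition clifford_module :: "(real^'n^'n) list \<Rightarrow> bool" where
  "clifford_module Js \<longleftrightarrow>
     (\<forall>i<length Js. transpose (Js!i) = - (Js!i)) \<and>
     (\<forall>i<length Js. \<forall>j<length Js.
        Js!i ** Js!j + Js!j ** Js!i = mat (if i = j then -2 else 0))"

text \<open>Coordinates of the Heisenberg-type bracket [u,v] in R^k w.r.t. the orthonormal
  basis e_1..e_k: <e_i,[u,v]> = <J_{e_i} u, v>.\<close>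

definition heis_bracket :: "(real^'n^'n) list \<Rightarrow> real^'n \<Rightarrow> real^'n \<Rightarrow> real list" where
  "heis_bracket Js u v = map (\<lambda>J. (J *v u) \<bullet> v) Js"

definition Lag :: "(real^'n^'n) list \<Rightarrow> (real^'n) set set" where
  "Lag Js = {L. subspace L \<and>
      (\<forall>u\<in>L. \<forall>v\<in>L. heis_bracket Js u v = replicate (length Js) 0) \<and>
      2 * dim L = CARD('n)}"

text \<open>Tensor products, realised in coordinates: real^'a \<otimes> real^'b = real^('a \<times> 'b)
  with the standard (= tensor product) inner product.\<close>

definition tensor_vec :: "real^'a \<Rightarrow> real^'b \<Rightarrow> real^('a \<times> 'b)" where
  "tensor_vec x y = (\<chi> p. x $ fst p * y $ snd p)"

definition tensor_mat :: "real^'a^'a \<Rightarrow> real^'b^'b \<Rightarrow> real^('a \<times> 'b)^('a \<times> 'b)" where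
  "tensor_mat A B = (\<chi> p q. A $ fst p $ fst q * B $ snd p $ snd q)"

definition tensor_space :: "(real^'a) set \<Rightarrow> (real^'b) set \<Rightarrow> (real^('a \<times> 'b)) set" where
  "tensor_space L M = span {tensor_vec x y | x y. x \<in> L \<and> y \<in> M}"

definition subspace_sum :: "('v::real_vector) set \<Rightarrow> 'v set \<Rightarrow> 'v set" where
  "subspace_sum A B = {a + b | a b. a \<in> A \<and> b \<in> B}"

text \<open>K_8 = J_{z_1} ... J_{z_8} (product of the generators, in order).\<close>

definition Kprod :: "(real^'n^'n) list \<Rightarrow> real^'n^'n" where
  "Kprod Js = foldr (**) Js (mat 1)"

text \<open>Generators of the C(8+r)-module structure J_{(z,w)} = J_z \<otimes> Id + K_8 \<otimes> J_w,
  evaluated on the orthonormal basis (e_1,0),...,(e_8,0),(0,f_1),...,(0,f_r).\<close>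

definition tensor_gens :: "(real^'a^'a) list \<Rightarrow> (real^'b^'b) list
     \<Rightarrow> (real^('a \<times> 'b)^('a \<times> 'b)) list" where
  "tensor_gens Js8 Jsr =
     map (\<lambda>A. tensor_mat A (mat 1)) Js8 @ map (\<lambda>B. tensor_mat (Kprod Js8) B) Jsr"

end

theory Submission
  imports Defs
begin

(* A generator J of a Clifford module satisfies J^2 = -1, and isotropy of a Lagrangian L says that
   J maps L into its orthogonal complement; as J is injective and 2 dim L is the full dimension,
   J swaps L and its complement. Hence K_8, a product of an even number of generators, preserves
   L_8 and its complement.
   For pure tensors x (x) y and x' (x) y', each lying in L_8 (x) L_r or in the tensor product of
   the complements, <J u, v> for J = J_z (x) Id or K_8 (x) J_w is a product of a form on v_8 and
   a form on v_r, and in every case one factor vanishes. The two summands are orthogonal and each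
   has dimension (dim v_8 / 2)(dim v_r / 2), which gives half the dimension of v_8 (x) v_r. *)

lemma mat_mult_vector: "mat c *v x = c *s (x :: 'a::comm_ring_1^'n)"
  by (simp add: vec_eq_iff matrix_vector_mult_def mat_def mult_delta_left)

lemma orthogonal_comp_inner:
  "u \<in> L \<Longrightarrow> v \<in> orthogonal_comp L \<Longrightarrow> u \<bullet> v = 0"
  "u \<in> orthogonal_comp L \<Longrightarrow> v \<in> L \<Longrightarrow> u \<bullet> v = 0"
  unfolding orthogonal_comp_def orthogonal_def by (auto simp: inner_commute)

lemma dim_orthogonal_comp:
  fixes L :: "(real^'n) set"
  assumes "subspace L"
  shows "dim (orthogonal_comp L) + dim L = CARD('n)"
proof -
  have "{y \<in> UNIV. \<forall>x \<in> L. orthogonal x y} = orthogonal_comp L"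
    unfolding orthogonal_comp_def by auto
  then show ?thesis
    using dim_subspace_orthogonal_to_vectors[OF assms subspace_UNIV] by simp
qed

lemma dim_subspace_sum_orthogonal:
  fixes U V :: "'a::euclidean_space set"
  assumes "subspace U" "subspace V" "\<And>u v. u \<in> U \<Longrightarrow> v \<in> V \<Longrightarrow> u \<bullet> v = 0"
  shows "dim (subspace_sum U V) = dim U + dim V"
proof -
  have "U \<inter> V = {0}"
    using assms inner_eq_zero_iff by (fastforce simp: subspace_0)
  then show ?thesis
    using dim_sums_Int[OF assms(1,2)] unfolding subspace_sum_def by simp
qed

lemma bilinear_vanishes_on_spans:
  assumes "bilinear f" "\<And>x y. x \<in> S \<Longrightarrow> y \<in> T \<Longrightarrow> f x y = 0" "x \<in> span S" "y \<in> span T"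
  shows "f x y = 0"
proof -
  have "bilinear (\<lambda>x y. 0 :: 'c::real_vector)"
    by (simp add: bilinear_def linear_zero)
  then show ?thesis
    using bilinear_eq[OF assms(1) _ order_refl order_refl assms(3,4)] assms(2) by blast
qed

lemma even_product_mult_mem:
  fixes xs :: "('a::comm_ring_1^'n^'n) list"
  assumes "\<And>J u. J \<in> set xs \<Longrightarrow> u \<in> M \<Longrightarrow> J *v u \<in> N"
    and "\<And>J u. J \<in> set xs \<Longrightarrow> u \<in> N \<Longrightarrow> J *v u \<in> M"
    and "even (length xs)" "u \<in> M"
  shows "foldr (**) xs (mat 1) *v u \<in> M"
  using assms
proof (induction xs arbitrary: u rule: induct_list012)
  case (3 J J' xs)
  then have "foldr (**) xs (mat 1) *v u \<in> M"
    by simp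
  then show ?case
    using "3.prems"(1,2) by (simp add: matrix_vector_mul_assoc[symmetric])
qed simp_all

lemma isotropic_mult_mem_orthogonal_comp:
  assumes "\<forall>u\<in>L. \<forall>v\<in>L. (J *v u) \<bullet> v = 0" "u \<in> L"
  shows "J *v u \<in> orthogonal_comp L"
  using assms unfolding orthogonal_comp_def orthogonal_def by (simp add: inner_commute)

lemma isotropic_image_eq_orthogonal_comp:
  fixes J :: "real^'n^'n"
  assumes "subspace L" "2 * dim L = CARD('n)" "inj ((*v) J)"
    and "\<forall>u\<in>L. \<forall>v\<in>L. (J *v u) \<bullet> v = 0"
  shows "(*v) J ` L = orthogonal_comp L"
proof (rule subspace_dim_equal)
  show "subspace ((*v) J ` L)"
    using assms(1) by (rule linear_subspace_image[rotated]) simp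
  show "(*v) J ` L \<subseteq> orthogonal_comp L"
    using isotropic_mult_mem_orthogonal_comp[OF assms(4)] by blast
  have "dim ((*v) J ` L) = dim L"
    using assms(3) by (intro dim_image_eq) (auto intro: inj_on_subset)
  then show "dim (orthogonal_comp L) \<le> dim ((*v) J ` L)"
    using dim_orthogonal_comp[OF assms(1)] assms(2) by linarith
qed (rule subspace_orthogonal_comp)

lemma clifford_module_square:
  assumes "clifford_module Js" "J \<in> set Js"
  shows "J *v (J *v x) = - x"
proof -
  obtain i where "i < length Js" "J = Js ! i"
    using assms(2) by (auto simp: in_set_conv_nth)
  then have JJ: "J ** J + J ** J = mat (-2)"
    using assms(1) unfolding clifford_module_def by fastforce
  have "J *v (J *v x) + J *v (J *v x) = (J ** J + J ** J) *v x"
    unfolding matrix_vector_mul_assoc matrix_vector_mult_add_rdistrib ..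
  then show ?thesis
    unfolding JJ mat_mult_vector by (simp add: vec_eq_iff)
qed

lemma Lag_iff:
  "L \<in> Lag Js \<longleftrightarrow> subspace L \<and> (\<forall>J\<in>set Js. \<forall>u\<in>L. \<forall>v\<in>L. (J *v u) \<bullet> v = 0)
     \<and> 2 * dim L = CARD('n)"
  for Js :: "(real^'n^'n) list"
proof -
  have map_eq_zeros: "map f xs = replicate (length xs) 0 \<longleftrightarrow> (\<forall>x\<in>set xs. f x = 0)"
    for f :: "_ \<Rightarrow> real" and xs
    by (induction xs) auto
  show ?thesis
    unfolding Lag_def heis_bracket_def map_eq_zeros by auto
qed

lemma Lag_mult_mem_orthogonal_comp:
  "L \<in> Lag Js \<Longrightarrow> J \<in> set Js \<Longrightarrow> u \<in> L \<Longrightarrow> J *v u \<in> orthogonal_comp L"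
  unfolding Lag_iff using isotropic_mult_mem_orthogonal_comp by blast

lemma Lag_mult_orthogonal_comp_mem:
  assumes "clifford_module Js" "L \<in> Lag Js" "J \<in> set Js" "w \<in> orthogonal_comp L"
  shows "J *v w \<in> L"
proof -
  have "inj ((*v) J)"
    by (metis injI clifford_module_square[OF assms(1,3)] neg_equal_iff_equal)
  then have "(*v) J ` L = orthogonal_comp L"
    using assms(2,3) unfolding Lag_iff by (intro isotropic_image_eq_orthogonal_comp) auto
  then obtain u where "u \<in> L" "w = J *v u"
    using assms(4) by blast
  then show ?thesis
    using assms(2) clifford_module_square[OF assms(1,3)] by (simp add: Lag_iff subspace_neg)
qed

lemma Lag_form_vanishes:
  assumes "clifford_module Js" "L \<in> Lag Js" "J \<in> set Js"
    and "u \<in> L \<and> v \<in> L \<or> u \<in> orthogonal_comp L \<and> v \<in> orthogonal_comp L"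
  shows "(J *v u) \<bullet> v = 0"
  using assms(4)
proof
  assume "u \<in> L \<and> v \<in> L"
  then show ?thesis
    using assms(2,3) unfolding Lag_iff by blast
next
  assume "u \<in> orthogonal_comp L \<and> v \<in> orthogonal_comp L"
  then show ?thesis
    using Lag_mult_orthogonal_comp_mem[OF assms(1-3)] orthogonal_comp_inner(1) by blast
qed

lemma Lag_Kprod_mult_mem:
  assumes "clifford_module Js" "L \<in> Lag Js" "even (length Js)"
  shows "u \<in> L \<Longrightarrow> Kprod Js *v u \<in> L"
    and "u \<in> orthogonal_comp L \<Longrightarrow> Kprod Js *v u \<in> orthogonal_comp L"
  unfolding Kprod_def
  using Lag_mult_mem_orthogonal_comp[OF assms(2)] Lag_mult_orthogonal_comp_mem[OF assms(1,2)]
  by (blast intro: even_product_mult_mem assms(3))+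

lemma inner_tensor_vec: "tensor_vec a b \<bullet> tensor_vec c d = (a \<bullet> c) * (b \<bullet> d)"
  unfolding tensor_vec_def inner_vec_def
  by (simp add: UNIV_Times_UNIV[symmetric] sum.cartesian_product' sum_product
      del: UNIV_Times_UNIV) (simp add: ac_simps)

lemma tensor_mat_mult_tensor_vec: "tensor_mat A B *v tensor_vec x y = tensor_vec (A *v x) (B *v y)"
  unfolding tensor_vec_def tensor_mat_def
  by (simp add: vec_eq_iff matrix_vector_mult_def UNIV_Times_UNIV[symmetric] sum.cartesian_product' sum_product
      del: UNIV_Times_UNIV) (simp add: ac_simps)

lemma bilinear_tensor_vec: "bilinear tensor_vec"
  unfolding bilinear_def
  by (auto intro!: linearI simp: tensor_vec_def vec_eq_iff algebra_simps)

lemma subspace_tensor_space: "subspace (tensor_space A B)"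
  unfolding tensor_space_def by (rule subspace_span)

lemma tensor_space_span:
  "tensor_space (span B) (span C) = span {tensor_vec b c | b c. b \<in> B \<and> c \<in> C}"
proof
  let ?T = "span {tensor_vec b c | b c. b \<in> B \<and> c \<in> C}"
  have lin: "linear (\<lambda>x. tensor_vec x y)" "linear (tensor_vec x)" for x y
    using bilinear_tensor_vec unfolding bilinear_def by auto
  have left_pure: "tensor_vec b y \<in> ?T" if "b \<in> B" "y \<in> span C" for b y
  proof -
    have "tensor_vec b ` C \<subseteq> ?T"
      using that(1) by (auto intro: span_base)
    then have "span (tensor_vec b ` C) \<subseteq> ?T"
      by (rule span_minimal) (rule subspace_span)
    then show ?thesis
      using that(2) unfolding span_linear_image[OF lin(2)] by blast
  qed
  have "tensor_vec x y \<in> ?T" if "x \<in> span B" "y \<in> span C" for x y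
  proof -
    have "span ((\<lambda>x. tensor_vec x y) ` B) \<subseteq> ?T"
      using that(2) left_pure by (intro span_minimal subspace_span) blast
    then show ?thesis
      using that(1) unfolding span_linear_image[OF lin(1)] by blast
  qed
  then show "tensor_space (span B) (span C) \<subseteq> ?T"
    unfolding tensor_space_def by (intro span_minimal subspace_span) blast
  show "?T \<subseteq> tensor_space (span B) (span C)"
    unfolding tensor_space_def by (intro span_mono) (blast intro: span_base)
qed

lemma tensor_space_orthogonal:
  fixes A A' :: "(real^'a) set" and B B' :: "(real^'b) set"
  assumes "\<And>x x'. x \<in> A \<Longrightarrow> x' \<in> A' \<Longrightarrow> x \<bullet> x' = 0"
    and "u \<in> tensor_space A B" "v \<in> tensor_space A' B'"
  shows "u \<bullet> v = 0"
  using bilinear_conv_bounded_bilinear[THEN iffD2, OF bounded_bilinear_inner] _ assms(2,3)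
  unfolding tensor_space_def
  by (rule bilinear_vanishes_on_spans) (auto simp: inner_tensor_vec assms(1))

lemma dim_tensor_space:
  fixes A :: "(real^'a) set" and A' :: "(real^'b) set"
  assumes "subspace A" "subspace A'"
  shows "dim (tensor_space A A') = dim A * dim A'"
proof -
  obtain B where B: "pairwise orthogonal B" "\<And>x. x \<in> B \<Longrightarrow> norm x = 1"
      "independent B" "card B = dim A" "span B = A"
    using orthonormal_basis_subspace[OF assms(1)] by blast
  obtain C where C: "pairwise orthogonal C" "\<And>x. x \<in> C \<Longrightarrow> norm x = 1"
      "independent C" "card C = dim A'" "span C = A'"
    using orthonormal_basis_subspace[OF assms(2)] by blast
  have orthonormal: "x \<bullet> x' = (if x = x' then 1 else 0)"
    if "pairwise orthogonal S" "\<And>x. x \<in> S \<Longrightarrow> norm x = 1" "x \<in> S" "x' \<in> S"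
    for S :: "(real^'c) set" and x x'
    using that by (auto simp: pairwise_def orthogonal_def power2_norm_eq_inner[symmetric])
  define f :: "(real^'a) \<times> (real^'b) \<Rightarrow> real^('a \<times> 'b)" where "f = (\<lambda>(x, y). tensor_vec x y)"
  have f_inner: "f p \<bullet> f q = (if p = q then 1 else 0)" if "p \<in> B \<times> C" "q \<in> B \<times> C" for p q
    using that orthonormal[OF B(1,2)] orthonormal[OF C(1,2)]
    by (auto simp: f_def inner_tensor_vec split: if_splits)
  have inj: "inj_on f (B \<times> C)"
    by (rule inj_onI) (metis f_inner zero_neq_one)
  have "pairwise orthogonal (f ` (B \<times> C))"
    unfolding pairwise_def orthogonal_def using f_inner by auto
  moreover have "0 \<notin> f ` (B \<times> C)"
    using f_inner by (metis imageE inner_zero_left zero_neq_one)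
  ultimately have "independent (f ` (B \<times> C))"
    by (rule pairwise_orthogonal_independent)
  moreover have "{tensor_vec b c | b c. b \<in> B \<and> c \<in> C} = f ` (B \<times> C)"
    by (auto simp: f_def)
  then have "tensor_space A A' = span (f ` (B \<times> C))"
    unfolding B(5)[symmetric] C(5)[symmetric] tensor_space_span by simp
  ultimately have "dim (tensor_space A A') = card B * card C"
    using card_image[OF inj] by (simp add: dim_eq_card_independent card_cartesian_product)
  then show ?thesis
    using B(4) C(4) by simp
qed

lemma tensor_gens_form_vanishes_pure:
  fixes Js8 :: "(real^'a^'a) list" and Jsr :: "(real^'b^'b) list"
  assumes "even (length Js8)" "clifford_module Js8" "clifford_module Jsr"
    and "L8 \<in> Lag Js8" "Lr \<in> Lag Jsr" "G \<in> set (tensor_gens Js8 Jsr)"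
    and "x \<in> L8 \<and> y \<in> Lr \<or> x \<in> orthogonal_comp L8 \<and> y \<in> orthogonal_comp Lr"
    and "x' \<in> L8 \<and> y' \<in> Lr \<or> x' \<in> orthogonal_comp L8 \<and> y' \<in> orthogonal_comp Lr"
  shows "(G *v tensor_vec x y) \<bullet> tensor_vec x' y' = 0"
proof -
  note form = tensor_mat_mult_tensor_vec inner_tensor_vec
  note vanish8 = Lag_form_vanishes[OF assms(2,4)] and vanishr = Lag_form_vanishes[OF assms(3,5)]
  note K = Lag_Kprod_mult_mem[OF assms(2,4,1)]
  from assms(6) consider (left) A where "A \<in> set Js8" "G = tensor_mat A (mat 1)"
    | (right) B where "B \<in> set Jsr" "G = tensor_mat (Kprod Js8) B"
    unfolding tensor_gens_def by auto
  then show ?thesis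
  proof cases
    case left
    have "(A *v x) \<bullet> x' = 0 \<or> y \<bullet> y' = 0"
      using assms(7,8) vanish8[OF left(1), of x x'] orthogonal_comp_inner[of y Lr y'] by blast
    then show ?thesis
      unfolding left(2) form matrix_vector_mul_lid by auto
  next
    case right
    have "(Kprod Js8 *v x) \<bullet> x' = 0 \<or> (B *v y) \<bullet> y' = 0"
      using assms(7,8) vanishr[OF right(1), of y y'] orthogonal_comp_inner[of "Kprod Js8 *v x" L8 x'] K
      by blast
    then show ?thesis
      unfolding right(2) form by auto
  qed
qed

lemma tensor_gens_form_vanishes:
  fixes Js8 :: "(real^'a^'a) list" and Jsr :: "(real^'b^'b) list"
  assumes "even (length Js8)" "clifford_module Js8" "clifford_module Jsr"
    and "L8 \<in> Lag Js8" "Lr \<in> Lag Jsr" "G \<in> set (tensor_gens Js8 Jsr)"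
    and "u \<in> subspace_sum (tensor_space L8 Lr) (tensor_space (orthogonal_comp L8) (orthogonal_comp Lr))"
    and "v \<in> subspace_sum (tensor_space L8 Lr) (tensor_space (orthogonal_comp L8) (orthogonal_comp Lr))"
  shows "(G *v u) \<bullet> v = 0"
proof -
  let ?S = "{tensor_vec x y | x y. x \<in> L8 \<and> y \<in> Lr}
    \<union> {tensor_vec x y | x y. x \<in> orthogonal_comp L8 \<and> y \<in> orthogonal_comp Lr}"
  have "bilinear (\<lambda>u v. (G *v u) \<bullet> v)"
    unfolding bilinear_def
    by (auto intro!: linearI simp: matrix_vector_right_distrib inner_add_left inner_add_right
        matrix_vector_mult_scaleR)
  moreover have "(G *v s) \<bullet> t = 0" if "s \<in> ?S" "t \<in> ?S" for s t
    using that tensor_gens_form_vanishes_pure[OF assms(1-6)] by blast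
  moreover have "u \<in> span ?S" "v \<in> span ?S"
    using assms(7,8) unfolding span_Un subspace_sum_def tensor_space_def by simp_all
  ultimately show ?thesis
    by (rule bilinear_vanishes_on_spans)
qed

theorem theorem4p5:
  fixes Js8 :: "(real^'a^'a) list" and Jsr :: "(real^'b^'b) list"
    and L8 :: "(real^'a) set" and Lr :: "(real^'b) set"
  assumes "length Js8 = 8"
    and "clifford_module Js8"
    and "clifford_module Jsr"
    and "L8 \<in> Lag Js8"
    and "Lr \<in> Lag Jsr"
  shows "subspace_sum (tensor_space L8 Lr) (tensor_space (orthogonal_comp L8) (orthogonal_comp Lr))
           \<in> Lag (tensor_gens Js8 Jsr)"
proof -
  let ?P = "tensor_space L8 Lr" and ?Q = "tensor_space (orthogonal_comp L8) (orthogonal_comp Lr)"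
  have L8: "subspace L8" "2 * dim L8 = CARD('a)" and Lr: "subspace Lr" "2 * dim Lr = CARD('b)"
    using assms(4,5) unfolding Lag_iff by auto
  have "dim (orthogonal_comp L8) = dim L8" "dim (orthogonal_comp Lr) = dim Lr"
    using dim_orthogonal_comp[OF L8(1)] dim_orthogonal_comp[OF Lr(1)] L8(2) Lr(2) by linarith+
  then have "dim ?P = dim L8 * dim Lr" "dim ?Q = dim L8 * dim Lr"
    by (simp_all add: dim_tensor_space L8(1) Lr(1) subspace_orthogonal_comp)
  moreover have "dim (subspace_sum ?P ?Q) = dim ?P + dim ?Q"
    by (rule dim_subspace_sum_orthogonal[OF subspace_tensor_space subspace_tensor_space
        tensor_space_orthogonal[OF orthogonal_comp_inner(1)]])
  moreover have "subspace (subspace_sum ?P ?Q)"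
    unfolding subspace_sum_def by (intro subspace_sums subspace_tensor_space)
  moreover have "2 * (dim L8 * dim Lr + dim L8 * dim Lr) = CARD('a \<times> 'b)"
    by (simp flip: L8(2) Lr(2))
  ultimately show ?thesis
    unfolding Lag_iff using tensor_gens_form_vanishes[OF _ assms(2-5)] assms(1) by simp
qed

end
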